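(* For all integers $n>p\ge 0$, $$\sum_{k=p+1}^{n}\sum_{j=0}^{p}\binom{n}{k}{k\brace p+1}{p\brack j}(-1)^{j}B_{n+j-k}=\frac{p^{\,n-1}\,(n-pH_{p})}{p+1}+\frac{p!}{p+1}\sum_{j=1}^{p}{n\brace p-j}\frac{H_{j}}{j!}.$$
   Context: $B_m$ is the $m$th Bernoulli number, $\sum_{m\ge 0}B_m\frac{t^m}{m!}=\frac{t}{e^t-1}$ (so $B_1=-\tfrac12$). ${n\brace k}$ denotes the Stirling number of the second kind, i.e. $\sum_{n\ge 0}{n\brace k}\frac{t^n}{n!}=\frac{(e^t-1)^k}{k!}$. ${p\brack j}$ denotes the unsigned Stirling number of the first kind (the number of permutations of $p$ elements with exactly $j$ cycles, with ${0\brack 0}=1$). $H_n=\sum_{j=1}^{n}\frac1j$ is the $n$th harmonic number, with $H_0=0$; empty sums are $0$. The convention $0^0=1$ is used (relevant for $p=0$, $n=1$). *)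

theory Defs
  imports
    "HOL-Analysis.Analysis"
    "HOL-Combinatorics.Stirling"
    "HOL-Computational_Algebra.Formal_Power_Series"
begin

definition bernoulli :: "nat \<Rightarrow> real" where
  "bernoulli m = fact m * fps_nth (fps_X / (fps_exp 1 - 1)) m"

(* fps_exp 1 - 1 is not a unit; the next lemma confirms that the division above is the exact one. *)
lemma bernoulli_egf:
  "Abs_fps (\<lambda>m. bernoulli m / fact m) * (fps_exp 1 - 1) = fps_X"
proof -
  have eq: "Abs_fps (\<lambda>m. bernoulli m / fact m) = fps_X / (fps_exp 1 - 1)"
    by (simp add: fps_eq_iff bernoulli_def)
  have nz: "fps_nth (fps_exp 1 - 1 :: real fps) 1 \<noteq> 0"
    by simp
  have "(fps_exp 1 - 1 :: real fps) \<noteq> 0"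
    using nz by (metis fps_zero_nth)
  moreover have "subdegree (fps_exp 1 - 1 :: real fps) = 1"
    by (rule subdegreeI) auto
  ultimately have "(fps_exp 1 - 1 :: real fps) dvd fps_X"
    by (simp add: fps_dvd_iff)
  then show ?thesis
    unfolding eq by (rule dvd_div_mult_self)
qed

lemma bernoulli_0: "bernoulli 0 = 1"
  using arg_cong[OF bernoulli_egf, of "\<lambda>f. fps_nth f 1"]
  by (simp add: fps_mult_nth)

lemma bernoulli_1: "bernoulli 1 = - 1 / 2"
  using arg_cong[OF bernoulli_egf, of "\<lambda>f. fps_nth f 2"]
  by (simp add: fps_mult_nth numeral_2_eq_2 bernoulli_0)

lemma Stirling_egf:
  "Abs_fps (\<lambda>n. real (Stirling n k) / fact n) = fps_const (1 / fact k) * (fps_exp 1 - 1) ^ k"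
proof -
  define G :: "nat \<Rightarrow> real fps" where "G k = fps_const (1 / fact k) * (fps_exp 1 - 1) ^ k" for k
  have deriv: "fps_deriv (G (Suc k)) = fps_const (real (Suc k)) * G (Suc k) + G k" for k
  proof -
    have c: "fps_const (1 / fact (Suc k)) * fps_const (real (Suc k)) = fps_const (1 / fact k :: real)"
      by (simp add: field_simps del: of_nat_Suc)
    have "fps_deriv (G (Suc k)) = fps_const (1 / fact (Suc k)) * fps_const (real (Suc k))
        * ((fps_exp 1 - 1) ^ k * fps_exp 1)"
    proof -
      have "fps_deriv ((fps_exp 1 - 1 :: real fps) ^ Suc k)
          = fps_const (real (Suc k)) * fps_exp 1 * (fps_exp 1 - 1) ^ k"
        by (subst fps_deriv_power) (simp del: power_Suc of_nat_Suc)
      then show ?thesis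
        unfolding G_def by (simp only: fps_deriv_mult_const_left mult.assoc mult.left_commute mult.commute)
    qed
    also have "\<dots> = fps_const (1 / fact (Suc k)) * fps_const (real (Suc k))
        * ((fps_exp 1 - 1) ^ Suc k + (fps_exp 1 - 1) ^ k)"
      by (simp add: algebra_simps)
    also have "\<dots> = fps_const (real (Suc k)) * G (Suc k)
        + fps_const (1 / fact (Suc k)) * fps_const (real (Suc k)) * (fps_exp 1 - 1) ^ k"
      unfolding G_def by (simp only: algebra_simps)
    finally show ?thesis
      unfolding c by (simp only: G_def)
  qed
  have "real (Stirling n k) = fact n * fps_nth (G k) n" for n k
  proof (induction n k rule: Stirling.induct)
    case (4 n k)
    have "real (Suc n) * fps_nth (G (Suc k)) (Suc n)
        = real (Suc k) * fps_nth (G (Suc k)) n + fps_nth (G k) n"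
      using arg_cong[OF deriv[of k], of "\<lambda>f. fps_nth f n"]
      by (simp del: of_nat_Suc)
    then have "fact (Suc n) * fps_nth (G (Suc k)) (Suc n)
        = fact n * (real (Suc k) * fps_nth (G (Suc k)) n + fps_nth (G k) n)"
      by (simp add: mult.assoc mult.left_commute)
    then show ?case
      using 4 by (simp add: algebra_simps)
  qed (simp_all add: G_def fps_nth_power_0)
  then show ?thesis
    by (simp add: fps_eq_iff G_def)
qed

end

theory Submission
  imports Defs
begin

text \<open>
  Put \<open>u = e\<^sup>t\<close>, so that \<open>D = d/dt\<close> is \<open>u d/du\<close> and \<open>t / (e\<^sup>t - 1) = ln u / (u - 1)\<close>. By the
  binomial convolution, the left-hand side is \<open>n!\<close> times the coefficient of \<open>t\<^sup>n\<close> in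
  \<open>(u - 1)\<^bsup>p+1\<^esup> / (p+1)!\<close> times \<open>\<Sum>\<^sub>j [p,j] (-D)\<^sup>j = (-1)\<^sup>p u\<^sup>p (d/du)\<^sup>p\<close> applied to
  \<open>ln u / (u - 1)\<close>. Leibniz' rule makes this product equal to
  \<open>(t u\<^sup>p - \<Sum>\<^bsub>1\<le>j\<le>p\<^esub> u\<^bsup>p-j\<^esup> (u - 1)\<^sup>j / j) / (p+1)\<close>. Expanding the last sum in powers of \<open>u - 1\<close>
  turns its coefficients into harmonic numbers, and those powers generate the Stirling numbers.
\<close>

text \<open>
  The recurrence below shows that this is \<open>\<Sum>\<^bsub>1\<le>j\<le>p\<^esub> u\<^bsup>p-j\<^esup> (u - 1)\<^sup>j / j\<close>, i.e. \<open>u\<^sup>p\<close> times a partial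
  sum of the series of \<open>ln u = - ln (1 - (u - 1) / u)\<close>.
\<close>
definition log_partial :: "nat \<Rightarrow> real fps" where
  "log_partial p = fps_const (harm p) * fps_exp 1 ^ p
     - (\<Sum>j\<le>p. fps_const (real (p choose j) * harm j) * (fps_exp 1 - 1) ^ (p - j))"

lemma log_partial_0: "log_partial 0 = 0"
  by (simp add: log_partial_def)

text \<open>Pascal's rule gives two sums, both with \<open>harm (Suc j)\<close>. One is
  \<open>w\<close> times the sum for \<open>p\<close>; in the other, splitting off 1/(j+1) leaves
  the sum for \<open>p\<close> and a tail. Absorption, (p choose j)/(j+1) = (p+1 choose j+1)/(p+1),
  makes the tail a binomial expansion short of its leading power of \<open>w\<close>.\<close>

lemma sum_binomial_harm_Suc:
  fixes w :: "real fps"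
  shows "(\<Sum>j\<le>Suc p. fps_const (real (Suc p choose j) * harm j) * w ^ (Suc p - j))
       = (w + 1) * (\<Sum>j\<le>p. fps_const (real (p choose j) * harm j) * w ^ (p - j))
         + fps_const (1 / real (Suc p)) * ((w + 1) ^ Suc p - w ^ Suc p)"
proof -
  define T where "T = (\<Sum>j\<le>p. fps_const (real (p choose j) * harm j) * w ^ (p - j))"
  have binom: "(\<Sum>j\<le>p. fps_const (real (Suc p choose Suc j)) * w ^ (p - j))
      = (w + 1) ^ Suc p - w ^ Suc p"
  proof -
    have "(w + 1) ^ Suc p = (\<Sum>j\<le>Suc p. of_nat (Suc p choose j) * w ^ (Suc p - j))"
      using binomial_ring[of 1 w "Suc p"] by (simp add: add.commute)
    also have "\<dots> = w ^ Suc p + (\<Sum>j\<le>p. of_nat (Suc p choose Suc j) * w ^ (p - j))"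
      by (subst sum.atMost_Suc_shift) simp
    finally show ?thesis
      by (simp add: fps_of_nat del: binomial_Suc_Suc power_Suc)
  qed
  have tail: "(\<Sum>j\<le>p. fps_const (real (p choose j) / real (Suc j)) * w ^ (p - j))
      = fps_const (1 / real (Suc p)) * ((w + 1) ^ Suc p - w ^ Suc p)"
  proof -
    have "real (p choose j) / real (Suc j) = 1 / real (Suc p) * real (Suc p choose Suc j)" for j
    proof -
      have "real (Suc j) * real (Suc p choose Suc j) = real (Suc p) * real (p choose j)"
        by (metis Suc_times_binomial_eq mult.commute of_nat_mult)
      then show ?thesis
        by (simp add: field_simps del: of_nat_Suc binomial_Suc_Suc)
    qed
    then have "fps_const (real (p choose j) / real (Suc j))
        = fps_const (1 / real (Suc p)) * fps_const (real (Suc p choose Suc j))" for j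
      by (simp only: fps_const_mult)
    then show ?thesis
      unfolding binom[symmetric] by (simp only: sum_distrib_left mult.assoc)
  qed
  have "(\<Sum>j\<le>Suc p. fps_const (real (Suc p choose j) * harm j) * w ^ (Suc p - j))
      = (\<Sum>j\<le>p. fps_const (real (Suc p choose Suc j) * harm (Suc j)) * w ^ (p - j))"
    by (subst sum.atMost_Suc_shift) (simp add: harm_def del: binomial_Suc_Suc)
  also have "\<dots> = (\<Sum>j\<le>p. fps_const (real (p choose Suc j) * harm (Suc j)) * w ^ (p - j))
      + (\<Sum>j\<le>p. fps_const (real (p choose j) * harm (Suc j)) * w ^ (p - j))"
    unfolding sum.distrib[symmetric]
    by (intro sum.cong refl)
       (simp add: algebra_simps flip: fps_const_add fps_const_mult)
  also have "(\<Sum>j\<le>p. fps_const (real (p choose Suc j) * harm (Suc j)) * w ^ (p - j)) = w * T"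
  proof -
    have "w * T = (\<Sum>j\<le>p. fps_const (real (p choose j) * harm j) * w ^ (Suc p - j))"
      unfolding T_def sum_distrib_left
      by (intro sum.cong refl) (simp add: Suc_diff_le mult_ac)
    \<comment> \<open>The changes of range are free: \<open>p choose Suc p = 0\<close> at the top
      and \<open>harm 0 = 0\<close> at the bottom.\<close>
    also have "\<dots> = (\<Sum>j\<le>Suc p. fps_const (real (p choose j) * harm j) * w ^ (Suc p - j))"
      by simp
    also have "\<dots> = (\<Sum>j\<le>p. fps_const (real (p choose Suc j) * harm (Suc j)) * w ^ (p - j))"
      by (subst sum.atMost_Suc_shift) (simp add: harm_def)
    finally show ?thesis ..
  qed
  also have "(\<Sum>j\<le>p. fps_const (real (p choose j) * harm (Suc j)) * w ^ (p - j))
      = T + (\<Sum>j\<le>p. fps_const (real (p choose j) / real (Suc j)) * w ^ (p - j))"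
    unfolding T_def sum.distrib[symmetric] harm_Suc
    by (intro sum.cong refl)
       (simp add: distrib_left distrib_right divide_inverse del: of_nat_Suc flip: fps_const_add)
  finally show ?thesis
    unfolding tail T_def[symmetric] by (simp add: algebra_simps)
qed

lemma log_partial_Suc:
  "log_partial (Suc p) = fps_exp 1 * log_partial p
     + fps_const (1 / real (Suc p)) * (fps_exp 1 - 1) ^ Suc p"
  unfolding log_partial_def sum_binomial_harm_Suc harm_Suc fps_const_add[symmetric]
  by (simp add: algebra_simps inverse_eq_divide del: fps_const_add of_nat_Suc)

text \<open>With u = e^t and w = u - 1, differentiate u^p times the sum of (w/u)^j / j: as D(w/u) =
  1/u, what remains besides the multiple by p is the sum of u^(p-j) w^(j-1), which is u^p - w^p
  because u - w = 1. The induction reaches this without dividing by u.\<close>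

lemma deriv_log_partial:
  "fps_deriv (log_partial p)
     = of_nat p * log_partial p + fps_exp 1 ^ p - (fps_exp 1 - 1) ^ p"
proof (induction p)
  case 0
  show ?case by (simp add: log_partial_0)
next
  case (Suc p)
  define c1 :: "real fps" where "c1 = fps_const (1 / real (Suc p))"
  define n1 :: "real fps" where "n1 = of_nat (Suc p)"
  define u :: "real fps" where "u = fps_exp 1"
  define w where "w = u - 1"
  have D: "fps_deriv u = u" by (simp add: u_def)
  have Dw: "fps_deriv (w ^ Suc p) = n1 * u * w ^ p"
    by (subst fps_deriv_power') (simp add: w_def D n1_def del: of_nat_Suc)
  have cn: "c1 * n1 = 1"
    by (simp add: c1_def n1_def fps_of_nat[symmetric] del: of_nat_Suc)
  have L: "log_partial (Suc p) = u * log_partial p + c1 * w ^ Suc p"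
    using log_partial_Suc by (simp add: c1_def u_def w_def)
  have IH: "fps_deriv (log_partial p) = (n1 - 1) * log_partial p + u ^ p - w ^ p"
    using Suc.IH by (simp add: n1_def u_def w_def)
  have "fps_deriv (log_partial (Suc p))
      = u * log_partial p + u * ((n1 - 1) * log_partial p + u ^ p - w ^ p) + c1 * n1 * u * w ^ p"
    unfolding L by (simp only: fps_deriv_add fps_deriv_mult IH D Dw)
      (simp add: c1_def algebra_simps)
  also have "\<dots> = n1 * (u * log_partial p) + c1 * n1 * w ^ Suc p + u ^ Suc p - w ^ Suc p"
    unfolding cn by (simp add: algebra_simps)
  also have "\<dots> = n1 * log_partial (Suc p) + u ^ Suc p - w ^ Suc p"
    unfolding L by (simp add: algebra_simps)
  finally show ?case by (simp only: n1_def u_def w_def)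
qed

lemma nth_log_partial:
  "fact n * fps_nth (log_partial p) n
     = harm p * real p ^ n - fact p * (\<Sum>j=1..p. real (Stirling n (p - j)) * harm j / fact j)"
proof -
  have pow: "fact n * fps_nth ((fps_exp 1 - 1) ^ k) n = fact k * real (Stirling n k)" for k
    using arg_cong[OF Stirling_egf[of k], of "\<lambda>f. fps_nth f n"]
    by (simp add: field_simps)
  have "fact n * fps_nth (log_partial p) n = harm p * real p ^ n
      - (\<Sum>j\<le>p. real (p choose j) * harm j * (fact n * fps_nth ((fps_exp 1 - 1) ^ (p - j)) n))"
    by (simp add: log_partial_def fps_exp_power_mult fps_sum_nth sum_distrib_left algebra_simps)
  \<comment> \<open>The factor (p-j)! supplied by \<open>pow\<close> turns the binomial coefficient
    into p!/j!.\<close>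
  also have "(\<Sum>j\<le>p. real (p choose j) * harm j * (fact n * fps_nth ((fps_exp 1 - 1) ^ (p - j)) n))
      = (\<Sum>j\<le>p. fact p * (real (Stirling n (p - j)) * harm j / fact j))"
    unfolding pow by (intro sum.cong refl) (simp add: binomial_fact)
  also have "\<dots> = fact p * (\<Sum>j=1..p. real (Stirling n (p - j)) * harm j / fact j)"
    unfolding sum_distrib_left[symmetric]
    by (subst (2) sum.mono_neutral_left[of "{..p}"]) (auto simp: harm_def not_le)
  finally show ?thesis .
qed

text \<open>
  The series \<open>\<Sum>\<^sub>j [p,j] (-D)\<^sup>j (t / (e\<^sup>t - 1))\<close>, since differentiation shifts the coefficients of
  exponential generating functions.
\<close>
definition bernoulli_falling :: "nat \<Rightarrow> real fps" where
  "bernoulli_falling p =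
     Abs_fps (\<lambda>m. (\<Sum>j\<le>p. real (stirling p j) * (- 1) ^ j * bernoulli (m + j)) / fact m)"

lemma bernoulli_falling_0:
  "bernoulli_falling 0 * (fps_exp 1 - 1) = fps_X"
  using bernoulli_egf by (simp add: bernoulli_falling_def)

text \<open>The operator is the rising factorial (-D)(1-D)...(p-1-D), so the step to
  \<open>Suc p\<close> appends the factor p - D.\<close>

lemma bernoulli_falling_Suc:
  "bernoulli_falling (Suc p) = of_nat p * bernoulli_falling p - fps_deriv (bernoulli_falling p)"
proof (rule fps_ext)
  fix m
  have "(\<Sum>j\<le>Suc p. real (stirling (Suc p) j) * (- 1) ^ j * bernoulli (m + j))
      = (\<Sum>j\<le>p. real (stirling (Suc p) (Suc j)) * (- 1) ^ Suc j * bernoulli (m + Suc j))"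
    by (subst sum.atMost_Suc_shift) simp
  also have "\<dots> = real p * (\<Sum>j\<le>p. real (stirling p (Suc j)) * (- 1) ^ Suc j * bernoulli (m + Suc j))
      - (\<Sum>j\<le>p. real (stirling p j) * (- 1) ^ j * bernoulli (Suc m + j))"
    unfolding sum_distrib_left sum_subtractf[symmetric]
    by (intro sum.cong refl) (simp add: algebra_simps)
  \<comment> \<open>The added term at index 0 vanishes: either p = 0 kills the prefactor, or
    \<open>stirling p 0 = 0\<close>.\<close>
  also have "real p * (\<Sum>j\<le>p. real (stirling p (Suc j)) * (- 1) ^ Suc j * bernoulli (m + Suc j))
      = real p * (\<Sum>j\<le>Suc p. real (stirling p j) * (- 1) ^ j * bernoulli (m + j))"
    by (subst sum.atMost_Suc_shift) (cases p; simp)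
  also have "\<dots> = real p * (\<Sum>j\<le>p. real (stirling p j) * (- 1) ^ j * bernoulli (m + j))"
    by simp
  finally show "fps_nth (bernoulli_falling (Suc p)) m
      = fps_nth (of_nat p * bernoulli_falling p - fps_deriv (bernoulli_falling p)) m"
    by (simp add: bernoulli_falling_def fps_of_nat[symmetric] diff_divide_distrib
          del: sum.atMost_Suc of_nat_Suc)
qed

text \<open>Induction takes the place of Leibniz' rule. Differentiating the hypothesis expresses
  w^(p+1) DF up to a multiple of w^p F; the additional factor w in the next case turns this into
  w^(p+1) F, to which the hypothesis applies again.\<close>

lemma exp_minus_one_power_mult_bernoulli_falling:
  "(fps_exp 1 - 1) ^ Suc p * bernoulli_falling p
     = fps_const (fact p) * (fps_X * fps_exp 1 ^ p - log_partial p)"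
proof (induction p)
  case 0
  show ?case
    using bernoulli_falling_0 by (simp add: log_partial_0 mult.commute)
next
  case (Suc p)
  define u :: "real fps" where "u = fps_exp 1"
  define w where "w = u - 1"
  define c :: "real fps" where "c = fps_const (fact p)"
  define n :: "real fps" where "n = of_nat p"
  define c1 :: "real fps" where "c1 = fps_const (1 / real (Suc p))"
  define F where "F = bernoulli_falling p"
  define K where "K = log_partial p"
  have D: "fps_deriv u = u" by (simp add: u_def)
  have Dc: "fps_deriv c = 0" by (simp add: c_def)
  have Dup: "fps_deriv (u ^ p) = n * u ^ p"
    by (simp add: u_def n_def fps_exp_power_mult fps_of_nat)
  have Dw: "fps_deriv (w ^ Suc p) = (n + 1) * u * w ^ p"
    by (subst fps_deriv_power') (simp add: w_def D n_def add.commute)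
  have DK: "fps_deriv K = n * K + u ^ p - w ^ p"
    by (simp add: K_def deriv_log_partial n_def u_def w_def)
  have n1: "n + 1 = fps_const (real (Suc p))"
    by (simp add: n_def fps_of_nat[symmetric])
  have nc: "(n + 1) * c1 = 1"
    by (simp add: n1 c1_def del: of_nat_Suc)
  have fact_c: "fps_const (fact (Suc p)) = (n + 1) * c"
    by (simp add: n1 c_def del: of_nat_Suc)
  have LS: "log_partial (Suc p) = u * K + c1 * w ^ Suc p"
    by (simp only: log_partial_Suc c1_def u_def w_def K_def)
  have IH: "w ^ Suc p * F = c * (fps_X * u ^ p - K)"
    using Suc.IH by (simp only: F_def K_def u_def w_def c_def)
  have "fps_deriv (w ^ Suc p * F) = fps_deriv (c * (fps_X * u ^ p - K))"
    by (simp only: IH)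
  then have "w ^ Suc p * fps_deriv F + (n + 1) * u * w ^ p * F
      = c * (u ^ p + fps_X * (n * u ^ p) - (n * K + u ^ p - w ^ p))"
    by (simp only: fps_deriv_mult Dw Dc fps_deriv_sub fps_deriv_fps_X Dup DK) (simp add: algebra_simps)
  then have DF: "w ^ Suc p * fps_deriv F
      = c * (u ^ p + fps_X * (n * u ^ p) - (n * K + u ^ p - w ^ p)) - (n + 1) * u * w ^ p * F"
    by (simp only: eq_diff_eq)
  have "w ^ Suc (Suc p) * (n * F - fps_deriv F)
      = n * w * (w ^ Suc p * F) - w * (w ^ Suc p * fps_deriv F)"
    by (simp add: algebra_simps)
  also have "\<dots> = n * w * (w ^ Suc p * F)
      - w * (c * (u ^ p + fps_X * (n * u ^ p) - (n * K + u ^ p - w ^ p)))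
      + (n + 1) * u * (w ^ Suc p * F)"
    unfolding DF by (simp add: algebra_simps)
  \<comment> \<open>The multiples of w X u^p and of w K cancel. The factor
    \<open>(n + 1) * c1\<close>, equal to 1, is inserted to match the last term of
    \<open>LS\<close>.\<close>
  also have "\<dots> = (n + 1) * c * (fps_X * u ^ Suc p - u * K) - c * ((n + 1) * c1) * w ^ Suc p"
    unfolding IH nc by (simp add: algebra_simps)
  also have "\<dots> = (n + 1) * c * (fps_X * u ^ Suc p - log_partial (Suc p))"
    unfolding LS by (simp add: algebra_simps)
  finally show ?case
    unfolding fact_c bernoulli_falling_Suc by (simp only: u_def w_def F_def n_def)
qed

theorem corollary4:
  fixes n p :: nat
  assumes "n > p"
  shows "(\<Sum>k=p+1..n. \<Sum>j=0..p.
            real (n choose k) * real (Stirling k (p + 1)) * real (stirling p j)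
              * (- 1) ^ j * bernoulli (n + j - k))
       = real p ^ (n - 1) * (real n - real p * harm p) / (real p + 1)
         + fact p / (real p + 1)
             * (\<Sum>j=1..p. real (Stirling n (p - j)) * harm j / fact j)"
proof -
  define S :: "real fps" where "S = Abs_fps (\<lambda>k. real (Stirling k (p + 1)) / fact k)"
  let ?lhs = "\<Sum>k=p+1..n. \<Sum>j=0..p.
            real (n choose k) * real (Stirling k (p + 1)) * real (stirling p j)
              * (- 1) ^ j * bernoulli (n + j - k)"
  have "?lhs = (\<Sum>k=p+1..n. fact n * (fps_nth S k * fps_nth (bernoulli_falling p) (n - k)))"
  proof (rule sum.cong[OF refl])
    fix k assume "k \<in> {p+1..n}"
    then have k: "k \<le> n" by simp
    then show "(\<Sum>j=0..p. real (n choose k) * real (Stirling k (p + 1)) * real (stirling p j)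
              * (- 1) ^ j * bernoulli (n + j - k))
        = fact n * (fps_nth S k * fps_nth (bernoulli_falling p) (n - k))"
      by (simp add: S_def bernoulli_falling_def binomial_fact sum_distrib_left sum_divide_distrib
            atMost_atLeast0 mult_ac)
  qed
  \<comment> \<open>\<open>Stirling k (p + 1)\<close> vanishes for k <= p, so the range extends to a
    full Cauchy product.\<close>
  also have "\<dots> = (\<Sum>k=0..n. fact n * (fps_nth S k * fps_nth (bernoulli_falling p) (n - k)))"
    by (rule sum.mono_neutral_left) (auto simp: S_def)
  also have "\<dots> = fact n * fps_nth (S * bernoulli_falling p) n"
    by (simp add: fps_mult_nth sum_distrib_left)
  also have "S * bernoulli_falling p
      = fps_const (1 / (real p + 1)) * (fps_X * fps_exp 1 ^ p - log_partial p)"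
  proof -
    have "S * bernoulli_falling p
        = fps_const (1 / fact (Suc p)) * ((fps_exp 1 - 1) ^ Suc p * bernoulli_falling p)"
      unfolding S_def Stirling_egf by (simp add: mult.assoc)
    then show ?thesis
      unfolding exp_minus_one_power_mult_bernoulli_falling
      by (simp add: mult.assoc[symmetric] add.commute)
  qed
  also have "fact n * fps_nth (fps_const (1 / (real p + 1)) * (fps_X * fps_exp 1 ^ p - log_partial p)) n
      = (fact n * fps_nth (fps_X * fps_exp 1 ^ p) n - fact n * fps_nth (log_partial p) n)
          / (real p + 1)"
    by (simp add: algebra_simps diff_divide_distrib)
  \<comment> \<open>Here n > p makes n positive, so n - 1 is a true predecessor; p = 0, n = 1 yields
    0^0 = 1.\<close>
  also have "fact n * fps_nth (fps_X * fps_exp 1 ^ p) n = real n * real p ^ (n - 1)"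
    using assms by (cases n) (simp_all add: fps_exp_power_mult)
  finally have "?lhs = (real n * real p ^ (n - 1) - fact n * fps_nth (log_partial p) n) / (real p + 1)" .
  moreover have "real p ^ n = real p * real p ^ (n - 1)"
    using assms by (cases n) simp_all
  ultimately show ?thesis
    unfolding nth_log_partial
    by (simp add: add_divide_distrib[symmetric] right_diff_distrib mult_ac)
qed

end
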